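(* Let $G$ be a temporal graph with vertex set $V$, edge set $E$ and availability times $T$, let $s,t\in V$ be distinct vertices, let $\Gamma=\Gamma^{\mathrm{trp}}(s,t)$ be the family of time-respecting paths from $s$ to $t$, assumed nonempty, with temporal usage matrix $\mathcal{N}$, and let $p\in(1,\infty)$, $q=p/(p-1)$. For any $\sigma\in\mathbb{R}^E_{>0}$, let $\rho^*_\sigma$ be the unique optimal density for $\mathrm{Mod}_{p,\sigma}(\Gamma)$, and let $\eta^*_\sigma$ be the corresponding unique optimal edge usage of the associated mass transport problem, i.e. the unique vector $\eta\in\mathbb{R}^E_{\ge 0}$ minimizing $\sum_{e\in E}\sigma(e)^{-q/p}\eta(e)^q$ over all $\eta=\mathcal{N}^T\mu$ with $\mu\in\mathcal{P}(\Gamma)$. Then the following are true. 1. The function $\sigma\mapsto\rho^*_\sigma$ is continuous on $\mathbb{R}^E_{>0}$. 2. The function $F(\sigma):=\mathrm{Mod}_{p,\sigma}(\Gamma)$ is concave and differentiable on $\mathbb{R}^E_{>0}$, and its partial derivatives satisfy $$\frac{\partial F}{\partial\sigma(e)}=\rho^*_\sigma(e)^p\qquad\text{for all } e\in E.$$ 3. In each coordinate direction $e\in E$, the functions $\sigma\mapsto\mathrm{Mod}_{p,\sigma}(\Gamma)$ and $\sigma\mapsto\eta^*_\sigma(e)$ are nondecreasing, while $\sigma\mapsto\rho^*_\sigma(e)$ is nonincreasing. In other words, increasing $\sigma$ on a single edge $e$ (keeping the other weights fixed) cannot decrease the modulus nor the value $\eta^*_\sigma(e)$, and cannot increase $\r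ho^*_\sigma(e)$.
   Context: A temporal graph consists of a finite graph with vertex set $V$ and edge set $E$ (directed or undirected, parallel edges allowed), edge weights $\sigma\in\mathbb{R}^E_{>0}$, and a map $T$ assigning to each edge $e$ a finite nonempty set $T(e)\subset(0,\infty)$ of times at which $e$ is available. Here the graph and $T$ are fixed and $\sigma$ varies. A time-respecting path from $s$ to $t$ is a set of edge-time pairs $\gamma=\{(e_1,t_1),\dots,(e_k,t_k)\}$, with the edges $e_i$ pairwise distinct, such that $e_1e_2\cdots e_k$, traversed in order, is a path from $s$ to $t$, $t_i\in T(e_i)$ for all $i$, and $t_1<t_2<\cdots<t_k$. $\Gamma^{\mathrm{trp}}(s,t)$ is the (finite) set of all such paths. The temporal penalty function $\varphi:\mathbb{R}\to[0,\infty)$ is a fixed continuous, strictly increasing function with $\varphi(0)=1$. The temporal usage matrix $\mathcal{N}\in\mathbb{R}^{\Gamma\times E}_{\ge0}$ is given by $\mathcal{N}(\gamma,e)=\varphi(\tau)$ if $(e,\tau)\in\gamma$, and $\mathcal{N}(\gamma,e)=0$ if $e$ does not occur in $\gamma$. A density is a vector $\rho\in\mathbb{R}^E_{\ge0}$. Its $\rho$-length on $\gamma\in\Gamma$ is $\ell_\rho(\gamma)=\sum_{e\in E}\mathcal{N}(\gamma,e)\rho(e)$. The set of admissible densities is $\mathrm{Adm}(\Gamma)=\{\rho\in\mathbb{R}^E_{\ge0}:\ell_\rho(\gamma)\ge1\ \forall\gamma\in\Gamma\}$. For $1\le p<\infty$ the energy is $\mathcal{E}_{p,\sigma}(\rho)=\sum_{e\in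 E}\sigma(e)\rho(e)^p$, and the $p$-modulus is $\mathrm{Mod}_{p,\sigma}(\Gamma)=\min_{\rho\in\mathrm{Adm}(\Gamma)}\mathcal{E}_{p,\sigma}(\rho)$; a minimizer is called an optimal density, and it is unique for $p\in(1,\infty)$. $\mathcal{P}(\Gamma)=\{\mu\in\mathbb{R}^\Gamma_{\ge0}:\sum_{\gamma\in\Gamma}\mu(\gamma)=1\}$ is the set of probability mass functions on $\Gamma$, and $(\mathcal{N}^T\mu)(e)=\sum_{\gamma\in\Gamma}\mathcal{N}(\gamma,e)\mu(\gamma)$. *)

theory Defs
  imports "HOL-Analysis.Analysis"
begin

section \<open>Temporal graphs\<close>

text \<open>
  The edge set is the whole finite type \<open>'e\<close>, so that \<open>\<real>\<^sup>E\<close> is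
  the type \<open>real ^ 'e\<close>; parallel edges are distinct elements with the same end points.  (That
  types are nonempty is harmless: a time-respecting path between distinct vertices has an edge.)
  In an undirected graph, \<open>tail\<close> and \<open>head\<close> list the two ends of an edge in an arbitrary order.
\<close>

record ('v, 'e) temporal_graph =
  verts :: "'v set"
  directed :: bool
  tail :: "'e \<Rightarrow> 'v"
  head :: "'e \<Rightarrow> 'v"
  avail :: "'e \<Rightarrow> real set"

definition wf_temporal_graph :: "('v, 'e::finite) temporal_graph \<Rightarrow> bool" where
  "wf_temporal_graph G \<longleftrightarrow>
     finite (verts G) \<and>
     (\<forall>e. tail G e \<in> verts G \<and> head G e \<in> verts G) \<and>
     (\<forall>e. finite (avail G e) \<and> avail G e \<noteq> {} \<and> avail G e \<subseteq> {0<..})"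

definition traverses :: "('v, 'e) temporal_graph \<Rightarrow> 'e \<Rightarrow> 'v \<Rightarrow> 'v \<Rightarrow> bool" where
  "traverses G e u v \<longleftrightarrow>
     (tail G e = u \<and> head G e = v) \<or> (\<not> directed G \<and> head G e = u \<and> tail G e = v)"

text \<open>
  Edges \<open>es\<close>, used at the times \<open>ts\<close>, lead from \<open>s\<close> to \<open>t\<close> through the vertices \<open>us\<close>.
\<close>

definition time_respecting ::
    "('v, 'e) temporal_graph \<Rightarrow> 'v \<Rightarrow> 'v \<Rightarrow> 'v list \<Rightarrow> 'e list \<Rightarrow> real list \<Rightarrow> bool" where
  "time_respecting G s t us es ts \<longleftrightarrow>
     length us = Suc (length es) \<and> length ts = length es \<and>
     set us \<subseteq> verts G \<and> hd us = s \<and> last us = t \<and>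
     distinct es \<and>
     (\<forall>i<length es. traverses G (es ! i) (us ! i) (us ! Suc i)) \<and>
     (\<forall>i<length es. ts ! i \<in> avail G (es ! i)) \<and>
     sorted_wrt (<) ts"

text \<open>
  There are two conventions for ``path'': one asks only that no edge is repeated, the other that
  no vertex is repeated either.  Both families are provided.
\<close>

definition trps :: "('v, 'e) temporal_graph \<Rightarrow> 'v \<Rightarrow> 'v \<Rightarrow> ('e \<times> real) set set" where
  "trps G s t = {set (zip es ts) | us es ts. time_respecting G s t us es ts}"

definition simple_trps :: "('v, 'e) temporal_graph \<Rightarrow> 'v \<Rightarrow> 'v \<Rightarrow> ('e \<times> real) set set" where
  "simple_trps G s t =
     {set (zip es ts) | us es ts. time_respecting G s t us es ts \<and> distinct us}"

section \<open>Penalty function and usage matrix\<close>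

definition temporal_penalty :: "(real \<Rightarrow> real) \<Rightarrow> bool" where
  "temporal_penalty \<phi> \<longleftrightarrow>
     continuous_on UNIV \<phi> \<and> strict_mono \<phi> \<and> (\<forall>x. 0 \<le> \<phi> x) \<and> \<phi> 0 = 1"

text \<open>The time is unique because the edges of a time-respecting path are pairwise distinct.\<close>

definition usage :: "(real \<Rightarrow> real) \<Rightarrow> ('e \<times> real) set \<Rightarrow> 'e \<Rightarrow> real" where
  "usage \<phi> \<gamma> e = (if \<exists>\<tau>. (e, \<tau>) \<in> \<gamma> then \<phi> (THE \<tau>. (e, \<tau>) \<in> \<gamma>) else 0)"

section \<open>Modulus\<close>

definition pos_weights :: "(real ^ 'e::finite) set" where
  "pos_weights = {\<sigma>. \<forall>e. 0 < \<sigma> $ e}"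

definition rho_length ::
    "(real \<Rightarrow> real) \<Rightarrow> real ^ 'e::finite \<Rightarrow> ('e \<times> real) set \<Rightarrow> real" where
  "rho_length \<phi> \<rho> \<gamma> = (\<Sum>e\<in>UNIV. usage \<phi> \<gamma> e * \<rho> $ e)"

definition Adm ::
    "(real \<Rightarrow> real) \<Rightarrow> ('e \<times> real) set set \<Rightarrow> (real ^ 'e::finite) set" where
  "Adm \<phi> \<Gamma> = {\<rho>. (\<forall>e. 0 \<le> \<rho> $ e) \<and> (\<forall>\<gamma>\<in>\<Gamma>. 1 \<le> rho_length \<phi> \<rho> \<gamma>)}"

definition energy :: "real \<Rightarrow> real ^ 'e::finite \<Rightarrow> real ^ 'e \<Rightarrow> real" where
  "energy p \<sigma> \<rho> = (\<Sum>e\<in>UNIV. \<sigma> $ e * \<rho> $ e powr p)"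

definition modulus ::
    "(real \<Rightarrow> real) \<Rightarrow> ('e \<times> real) set set \<Rightarrow> real \<Rightarrow> real ^ 'e::finite \<Rightarrow> real" where
  "modulus \<phi> \<Gamma> p \<sigma> = (INF \<rho>\<in>Adm \<phi> \<Gamma>. energy p \<sigma> \<rho>)"

definition is_optimal_density :: "(real \<Rightarrow> real) \<Rightarrow> ('e \<times> real) set set \<Rightarrow> real \<Rightarrow>
    real ^ 'e::finite \<Rightarrow> real ^ 'e \<Rightarrow> bool" where
  "is_optimal_density \<phi> \<Gamma> p \<sigma> \<rho> \<longleftrightarrow> is_arg_min (energy p \<sigma>) (\<lambda>\<rho>. \<rho> \<in> Adm \<phi> \<Gamma>) \<rho>"

definition opt_density :: "(real \<Rightarrow> real) \<Rightarrow> ('e \<times> real) set set \<Rightarrow> real \<Rightarrow>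
    real ^ 'e::finite \<Rightarrow> real ^ 'e" where
  "opt_density \<phi> \<Gamma> p \<sigma> = (THE \<rho>. is_optimal_density \<phi> \<Gamma> p \<sigma> \<rho>)"

section \<open>Mass transport problem\<close>

text \<open>Values of \<open>\<mu>\<close> outside \<open>\<Gamma>\<close> are irrelevant: only sums over \<open>\<Gamma>\<close> are ever formed.\<close>

definition mass_functions :: "('e \<times> real) set set \<Rightarrow> (('e \<times> real) set \<Rightarrow> real) set" where
  "mass_functions \<Gamma> = {\<mu>. (\<forall>\<gamma>\<in>\<Gamma>. 0 \<le> \<mu> \<gamma>) \<and> (\<Sum>\<gamma>\<in>\<Gamma>. \<mu> \<gamma>) = 1}"

definition edge_usage :: "(real \<Rightarrow> real) \<Rightarrow> ('e \<times> real) set set \<Rightarrow>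
    (('e \<times> real) set \<Rightarrow> real) \<Rightarrow> real ^ 'e::finite" where
  "edge_usage \<phi> \<Gamma> \<mu> = (\<chi> e. \<Sum>\<gamma>\<in>\<Gamma>. usage \<phi> \<gamma> e * \<mu> \<gamma>)"

definition transport_cost :: "real \<Rightarrow> real \<Rightarrow> real ^ 'e::finite \<Rightarrow> real ^ 'e \<Rightarrow> real" where
  "transport_cost p q \<sigma> \<eta> = (\<Sum>e\<in>UNIV. \<sigma> $ e powr (- q / p) * \<eta> $ e powr q)"

definition is_optimal_usage :: "(real \<Rightarrow> real) \<Rightarrow> ('e \<times> real) set set \<Rightarrow> real \<Rightarrow> real \<Rightarrow>
    real ^ 'e::finite \<Rightarrow> real ^ 'e \<Rightarrow> bool" where
  "is_optimal_usage \<phi> \<Gamma> p q \<sigma> \<eta> \<longleftrightarrow>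
     is_arg_min (transport_cost p q \<sigma>) (\<lambda>\<eta>. \<eta> \<in> edge_usage \<phi> \<Gamma> ` mass_functions \<Gamma>) \<eta>"

definition opt_usage :: "(real \<Rightarrow> real) \<Rightarrow> ('e \<times> real) set set \<Rightarrow> real \<Rightarrow> real \<Rightarrow>
    real ^ 'e::finite \<Rightarrow> real ^ 'e" where
  "opt_usage \<phi> \<Gamma> p q \<sigma> = (THE \<eta>. is_optimal_usage \<phi> \<Gamma> p q \<sigma> \<eta>)"

end

theory Submission
  imports Defs
begin

text \<open>
  Both problems minimise \<open>\<Sum>\<^sub>e w(e) x(e)\<^sup>r\<close> with \<open>r > 1\<close> over a closed convex subset of the
  nonnegative orthant: the modulus with \<open>w = \<sigma>\<close>, the transport problem with
  \<open>w(e) = \<sigma>(e) powr (-q/p)\<close>.  The minimiser is unique by strict convexity, and it is continuous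
  in \<open>w\<close> because its graph is closed and it stays, locally in \<open>w\<close>, in a compact sublevel set.  The
  minimal value is an infimum of functions linear in \<open>w\<close>, hence concave; comparing the minimisers
  at \<open>w\<close> and \<open>w'\<close> as competitors for each other bounds its increment from both sides by linear
  forms that agree in the limit.  The same comparison, added up in both directions, gives
  \<open>\<Sum>\<^sub>e (w'(e) - w(e)) (x'(e)\<^sup>r - x(e)\<^sup>r) \<le> 0\<close>, hence the monotonicity of the minimiser in
  each coordinate, without any appeal to duality.
\<close>

section \<open>Minimising a weighted power sum\<close>

text \<open>By the mean value theorem between \<open>u\<close> and 1, the secant slope is
  \<open>r * z powr (r - 1)\<close>, which is below \<open>r\<close> for \<open>z < 1\<close> and
  above \<open>r\<close> for \<open>z > 1\<close>.\<close>

lemma Bernoulli_powr_strict: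
  fixes u r :: real
  assumes "1 < r" "0 \<le> u" "u \<noteq> 1"
  shows "1 + r * (u - 1) < u powr r"
proof -
  have der: "((\<lambda>x. x powr r) has_real_derivative r * z powr (r - 1)) (at z)" if "0 < z" for z
    using that has_real_derivative_powr by blast
  \<comment> \<open>The end point 0 is included: differentiability is only required inside the
    interval, so \<open>u = 0\<close> needs no separate case.\<close>
  have cont: "continuous_on {a..b} (\<lambda>x. x powr r)" if "0 \<le> a" for a b :: real
    using that assms by (intro continuous_on_powr' continuous_intros) auto
  have diff: "(\<lambda>x. x powr r) differentiable (at z)" if "0 < z" for z :: real
    using der[OF that] real_differentiable_def by blast
  consider "u < 1" | "1 < u" using assms by linarith
  then show ?thesis
  proof cases
    case 1
    obtain l z where z: "u < z" "z < 1" "((\<lambda>x. x powr r) has_real_derivative l) (at z)"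
      "1 powr r - u powr r = (1 - u) * l"
      using MVT[OF 1 cont[OF assms(2)] diff] assms(2) by fastforce
    have "l = r * z powr (r - 1)"
      using DERIV_unique[OF z(3) der] z(1) assms(2) by simp
    moreover have "z powr (r - 1) < 1"
      using powr_less_mono2[of "r - 1" z 1] z assms by simp
    ultimately have "l < r" using assms(1) by simp
    then have "(1 - u) * l < (1 - u) * r" using 1 by simp
    then show ?thesis using z(4) by (simp add: algebra_simps)
  next
    case 2
    obtain l z where z: "1 < z" "z < u" "((\<lambda>x. x powr r) has_real_derivative l) (at z)"
      "u powr r - 1 powr r = (u - 1) * l"
      using MVT[OF 2 cont diff] by fastforce
    have "l = r * z powr (r - 1)"
      using DERIV_unique[OF z(3) der] z(1) by simp
    moreover have "1 < z powr (r - 1)"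
      using powr_less_mono2[of "r - 1" 1 z] z assms by simp
    ultimately have "r < l" using assms(1) by simp
    then have "(u - 1) * r < (u - 1) * l" using 2 by simp
    then show ?thesis using z(4) by (simp add: algebra_simps)
  qed
qed

text \<open>After division by the midpoint \<open>m\<close>, the two points average to 1, so the
  linear terms of Bernoulli's inequality cancel in the sum.\<close>

lemma powr_midpoint_strict:
  fixes x y r :: real
  assumes "1 < r" "0 \<le> x" "0 \<le> y" "x \<noteq> y"
  shows "((x + y) / 2) powr r < (x powr r + y powr r) / 2"
proof -
  define m where "m = (x + y) / 2"
  have m: "0 < m" using assms unfolding m_def by auto
  have "x / m \<noteq> 1" "y / m \<noteq> 1" using assms m unfolding m_def by (auto simp: field_simps)
  then have "1 + r * (x / m - 1) < (x / m) powr r" "1 + r * (y / m - 1) < (y / m) powr r"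
    using Bernoulli_powr_strict[OF assms(1)] assms m by auto
  moreover have "x + y = 2 * m" by (simp add: m_def)
  then have "x / m + y / m = 2"
    using m by (simp add: add_divide_distrib[symmetric])
  then have "r * (x / m - 1) + r * (y / m - 1) = 0"
    using m by (simp add: distrib_left[symmetric])
  ultimately have "2 < (x / m) powr r + (y / m) powr r"
    by linarith
  also have "\<dots> = (x powr r + y powr r) / m powr r"
    using assms m by (simp add: powr_divide add_divide_distrib)
  finally show ?thesis
    using m by (simp add: m_def[symmetric] field_simps)
qed

lemma powr_midpoint:
  fixes x y r :: real
  assumes "1 < r" "0 \<le> x" "0 \<le> y"
  shows "((x + y) / 2) powr r \<le> (x powr r + y powr r) / 2"
  using powr_midpoint_strict[OF assms] by (cases "x = y") (auto simp: less_imp_le)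

section \<open>Positive weights and dependence of the energy on them\<close>

lemma pos_weights_pos: "w \<in> pos_weights \<Longrightarrow> 0 < w $ e"
  by (simp add: pos_weights_def)

lemma open_pos_weights: "open (pos_weights :: (real ^ 'e::finite) set)"
proof -
  have *: "pos_weights = (\<Inter>e. {w :: real ^ 'e. 0 < w $ e})"
    by (auto simp: pos_weights_def)
  show ?thesis
    unfolding * by (intro open_INT ballI finite open_Collect_less continuous_intros)
qed

lemma convex_pos_weights: "convex (pos_weights :: (real ^ 'e::finite) set)"
proof (rule convexI)
  fix v w :: "real ^ 'e" and a b :: real
  assume "v \<in> pos_weights" "w \<in> pos_weights" "0 \<le> a" "0 \<le> b" "a + b = 1"
  then have "0 < a * v $ e + b * w $ e" for e
    using pos_weights_pos[of v e] pos_weights_pos[of w e]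
    by (cases "a = 0") (auto intro!: add_pos_nonneg)
  then show "a *\<^sub>R v + b *\<^sub>R w \<in> pos_weights" by (simp add: pos_weights_def)
qed

lemma energy_mono:
  assumes "\<And>e. w $ e \<le> w' $ e"
  shows "energy r w x \<le> energy r w' x"
  unfolding energy_def by (intro sum_mono mult_right_mono assms) simp

text \<open>For fixed \<open>x\<close> the energy is linear in the weights. This drives both the
  derivative of the minimal value and the coordinate comparison of minimisers.\<close>

lemma energy_diff_weights:
  "energy r w' x - energy r w x = (\<chi> e. x $ e powr r) \<bullet> (w' - w)"
  by (simp add: energy_def inner_vec_def sum_subtractf[symmetric] algebra_simps)

section \<open>Existence and uniqueness of the minimiser\<close>

text \<open>Boundedness of \<open>A\<close> is not assumed, because the admissible densities form an
  unbounded set; compactness comes from sublevel sets.\<close>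

locale energy_minimization =
  fixes A :: "(real ^ 'e::finite) set" and r :: real
  assumes closed_A: "closed A" and convex_A: "convex A" and nonempty_A: "A \<noteq> {}"
    and nonneg_A: "x \<in> A \<Longrightarrow> 0 \<le> x $ e"
    and r_gt_1: "1 < r"
begin

definition minimal_energy :: "real ^ 'e \<Rightarrow> real" where
  "minimal_energy w = (INF x\<in>A. energy r w x)"

abbreviation is_minimizer :: "real ^ 'e \<Rightarrow> real ^ 'e \<Rightarrow> bool" where
  "is_minimizer w \<equiv> is_arg_min (energy r w) (\<lambda>x. x \<in> A)"

definition minimizer :: "real ^ 'e \<Rightarrow> real ^ 'e" where
  "minimizer w = (THE x. is_minimizer w x)"

lemma continuous_on_energy:
  "continuous_on (UNIV \<times> A) (\<lambda>(w, x). energy r w x)"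
  unfolding energy_def split_def
  using nonneg_A r_gt_1
  by (intro continuous_intros continuous_on_powr') auto

lemma continuous_on_energy_density: "continuous_on A (energy r w)"
proof -
  have "continuous_on A (Pair w)" by (intro continuous_intros)
  from continuous_on_compose2[OF continuous_on_energy this] show ?thesis by auto
qed

lemma compact_sublevel:
  assumes "w \<in> pos_weights"
  shows "compact {x \<in> A. energy r w x \<le> C}"
proof -
  have "closed {x \<in> A. energy r w x \<le> C}"
    using continuous_closed_preimage[OF continuous_on_energy_density closed_A, of "{..C}" w]
    by (simp add: vimage_def Int_def)
  \<comment> \<open>A single term of the energy is at most \<open>C\<close>, which bounds
    \<open>x $ e powr r\<close> by \<open>C / w $ e\<close>. This bounds \<open>x $ e\<close> itself
    when \<open>x $ e\<close> is at least 1; the summand 1 covers the other case.\<close>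
  moreover have "{x \<in> A. energy r w x \<le> C} \<subseteq> cbox 0 (\<chi> e. 1 + C / w $ e)"
  proof
    fix x assume x: "x \<in> {x \<in> A. energy r w x \<le> C}"
    have "x $ e \<le> 1 + C / w $ e" for e
    proof -
      have "w $ e * x $ e powr r \<le> energy r w x"
        unfolding energy_def
        by (rule member_le_sum) (use assms in \<open>auto simp: pos_weights_def less_imp_le\<close>)
      then have "w $ e * x $ e powr r \<le> C" using x by auto
      then have le: "x $ e powr r \<le> C / w $ e"
        using pos_weights_pos[OF assms, of e] by (simp add: field_simps)
      show ?thesis
      proof (cases "1 \<le> x $ e")
        case True
        then have "x $ e powr 1 \<le> x $ e powr r"
          using r_gt_1 by (intro powr_mono) auto
        then show ?thesis using le True by simp
      next
        case False
        then show ?thesis using le by (smt (verit) powr_ge_zero)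
      qed
    qed
    then show "x \<in> cbox 0 (\<chi> e. 1 + C / w $ e)"
      using x nonneg_A by (auto simp: mem_box_cart)
  qed
  ultimately show ?thesis
    by (meson bounded_cbox bounded_subset compact_eq_bounded_closed)
qed

lemma ex1_minimizer:
  assumes w: "w \<in> pos_weights"
  shows "\<exists>!x. is_minimizer w x"
proof (rule ex_ex1I)
  obtain a where a: "a \<in> A" using nonempty_A by blast
  \<comment> \<open>Points of \<open>A\<close> outside \<open>?K\<close> have larger energy than
    \<open>a\<close>, so a minimum over the compact set \<open>?K\<close> is global.\<close>
  let ?K = "{x \<in> A. energy r w x \<le> energy r w a}"
  have "continuous_on ?K (energy r w)"
    by (rule continuous_on_subset[OF continuous_on_energy_density]) auto
  moreover have "?K \<noteq> {}" using a by auto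
  ultimately have "\<exists>x\<in>?K. \<forall>y\<in>?K. energy r w x \<le> energy r w y"
    by (intro continuous_attains_inf compact_sublevel[OF w])
  then obtain x where x: "x \<in> ?K" "\<forall>y\<in>?K. energy r w x \<le> energy r w y" ..
  have "energy r w x \<le> energy r w y" if "y \<in> A" for y
    using x that by (cases "y \<in> ?K") auto
  with x(1) have "is_minimizer w x"
    by (auto simp: is_arg_min_def not_less)
  then show "\<exists>x. is_minimizer w x" ..
next
  fix x y assume x: "is_minimizer w x" and y: "is_minimizer w y"
  show "x = y"
  proof (rule ccontr)
    assume "x \<noteq> y"
    then obtain e where e: "x $ e \<noteq> y $ e" by (auto simp: vec_eq_iff)
    have xA: "x \<in> A" and yA: "y \<in> A" using x y by (auto simp: is_arg_min_def)
    \<comment> \<open>The midpoint of two distinct minimisers would beat both: the coordinate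
      \<open>e\<close> where they differ has positive weight and makes the convexity inequality
      strict.\<close>
    define z where "z = (1/2) *\<^sub>R x + (1/2) *\<^sub>R y"
    have z: "z $ i = (x $ i + y $ i) / 2" for i by (simp add: z_def)
    have zA: "z \<in> A" unfolding z_def using convexD[OF convex_A xA yA, of "1/2" "1/2"] by simp
    have "energy r w z < (\<Sum>i\<in>UNIV. w $ i * ((x $ i powr r + y $ i powr r) / 2))"
      unfolding energy_def
    proof (rule sum_strict_mono_ex1)
      show "\<forall>i\<in>UNIV. w $ i * z $ i powr r \<le> w $ i * ((x $ i powr r + y $ i powr r) / 2)"
        unfolding z using pos_weights_pos[OF w] nonneg_A xA yA r_gt_1
        by (intro ballI mult_left_mono powr_midpoint) (auto simp: less_imp_le)
      have "w $ e * z $ e powr r < w $ e * ((x $ e powr r + y $ e powr r) / 2)"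
        unfolding z using pos_weights_pos[OF w] nonneg_A xA yA r_gt_1 e
        by (intro mult_strict_left_mono powr_midpoint_strict) auto
      then show "\<exists>i\<in>UNIV. w $ i * z $ i powr r < w $ i * ((x $ i powr r + y $ i powr r) / 2)"
        by blast
    qed simp
    also have "\<dots> = (energy r w x + energy r w y) / 2"
      by (simp add: energy_def sum.distrib sum_divide_distrib distrib_left add_divide_distrib)
    finally have "energy r w z < (energy r w x + energy r w y) / 2" .
    moreover have "energy r w x \<le> energy r w z" "energy r w y \<le> energy r w z"
      using x y zA by (auto simp: is_arg_min_def not_less)
    ultimately show False by (simp add: field_simps)
  qed
qed

lemma is_minimizer_minimizer: "w \<in> pos_weights \<Longrightarrow> is_minimizer w (minimizer w)"
  unfolding minimizer_def by (rule theI', rule ex1_minimizer)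

lemma minimizer_in: "w \<in> pos_weights \<Longrightarrow> minimizer w \<in> A"
  using is_minimizer_minimizer by (auto simp: is_arg_min_def)

lemma minimizer_le: "w \<in> pos_weights \<Longrightarrow> x \<in> A \<Longrightarrow> energy r w (minimizer w) \<le> energy r w x"
  using is_minimizer_minimizer by (auto simp: is_arg_min_def not_less)

lemma minimizer_eqI:
  assumes "w \<in> pos_weights" "x \<in> A" "\<And>y. y \<in> A \<Longrightarrow> energy r w x \<le> energy r w y"
  shows "minimizer w = x"
  using ex1_minimizer[OF assms(1)] is_minimizer_minimizer[OF assms(1)] assms(2,3)
  by (auto simp: is_arg_min_def not_less)

lemma minimal_energy_eq: "w \<in> pos_weights \<Longrightarrow> minimal_energy w = energy r w (minimizer w)"
  unfolding minimal_energy_def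
  by (intro cInf_eq_minimum) (auto intro: minimizer_in minimizer_le)

lemma minimal_energy_le: "w \<in> pos_weights \<Longrightarrow> x \<in> A \<Longrightarrow> minimal_energy w \<le> energy r w x"
  by (simp add: minimal_energy_eq minimizer_le)

section \<open>Continuity of the minimiser in the weights\<close>

text \<open>A map into a compact set is continuous if its graph is closed. This is applied on a box
  around each weight.\<close>

lemma continuous_on_minimizer: "continuous_on pos_weights minimizer"
  unfolding continuous_on_eq_continuous_at[OF open_pos_weights]
proof
  fix w :: "real ^ 'e" assume w: "w \<in> pos_weights"
  define S where "S = cbox ((1/2) *\<^sub>R w) (2 *\<^sub>R w)"
  obtain a where a: "a \<in> A" using nonempty_A by blast
  \<comment> \<open>\<open>T\<close> is one compact set for all weights \<open>v\<close> in the box: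
    the energy of the minimiser at \<open>w/2\<close> is at most its energy at \<open>v\<close>,
    hence at most that of the competitor \<open>a\<close> at \<open>v\<close>, hence at most that of
    \<open>a\<close> at \<open>2w\<close>.\<close>
  define T where "T = {x \<in> A. energy r ((1/2) *\<^sub>R w) x \<le> energy r (2 *\<^sub>R w) a}"
  have half: "(1/2) *\<^sub>R w \<in> pos_weights" using w by (auto simp: pos_weights_def)
  have S_pos: "v \<in> pos_weights" if "v \<in> S" for v
    using that half unfolding S_def mem_box_cart pos_weights_def by (blast intro: less_le_trans)
  have T: "compact T" unfolding T_def by (rule compact_sublevel[OF half])
  have fim: "minimizer v \<in> T" if v: "v \<in> S" for v
  proof -
    have "energy r ((1/2) *\<^sub>R w) (minimizer v) \<le> energy r v (minimizer v)"
      using v by (intro energy_mono) (auto simp: S_def mem_box_cart)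
    also have "\<dots> \<le> energy r v a" by (rule minimizer_le[OF S_pos[OF v] a])
    also have "\<dots> \<le> energy r (2 *\<^sub>R w) a"
      using v by (intro energy_mono) (auto simp: S_def mem_box_cart)
    finally show ?thesis using minimizer_in[OF S_pos[OF v]] by (simp add: T_def)
  qed
  \<comment> \<open>By uniqueness, being the minimiser is the same as satisfying one inequality per
    competitor \<open>y\<close>. Each inequality is a closed condition on the pair
    \<open>(v, x)\<close>.\<close>
  have graph: "(\<lambda>v. (v, minimizer v)) ` S =
      (S \<times> A) \<inter> (\<Inter>y\<in>A. {(v, x) \<in> S \<times> A. energy r v x - energy r v y \<le> 0})"
  proof (intro equalityI subsetI)
    fix z assume "z \<in> (\<lambda>v. (v, minimizer v)) ` S"
    then show "z \<in> (S \<times> A) \<inter> (\<Inter>y\<in>A. {(v, x) \<in> S \<times> A. energy r v x - energy r v y \<le> 0})"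
      using S_pos minimizer_in minimizer_le by auto
  next
    fix z assume z: "z \<in> (S \<times> A) \<inter> (\<Inter>y\<in>A. {(v, x) \<in> S \<times> A. energy r v x - energy r v y \<le> 0})"
    obtain v x where [simp]: "z = (v, x)" by fastforce
    have "minimizer v = x" using z by (intro minimizer_eqI S_pos) auto
    then show "z \<in> (\<lambda>v. (v, minimizer v)) ` S" using z by auto
  qed
  have "closed {(v, x) \<in> S \<times> A. energy r v x - energy r v y \<le> 0}" if y: "y \<in> A" for y
  proof -
    have "continuous_on (S \<times> A) (\<lambda>(v, x). energy r v x)"
      by (rule continuous_on_subset[OF continuous_on_energy]) auto
    moreover have "continuous_on (S \<times> A) (\<lambda>(v, x). energy r v y)"
      unfolding energy_def split_def by (intro continuous_intros)
    ultimately have "continuous_on (S \<times> A) (\<lambda>z. energy r (fst z) (snd z) - energy r (fst z) y)"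
      unfolding split_def by (rule continuous_on_diff)
    from continuous_closed_preimage[OF this, of "{..0}"] closed_A show ?thesis
      by (simp add: S_def closed_Times closed_cbox vimage_def Int_def split_def mem_Times_iff
          conj_assoc)
  qed
  then have "closed ((\<lambda>v. (v, minimizer v)) ` S)"
    unfolding graph using closed_A by (intro closed_Int closed_INT closed_Times) (auto simp: S_def)
  then have "continuous_on S minimizer"
    using continuous_from_closed_graph[OF T, of minimizer S] fim by auto
  moreover have "w \<in> interior S"
    using pos_weights_pos[OF w] by (auto simp: S_def interior_cbox mem_box_cart)
  ultimately show "continuous (at w) minimizer"
    by (rule continuous_on_interior)
qed

section \<open>Concavity and derivative of the minimal value\<close>

text \<open>The minimiser for the mixed weight \<open>?u\<close> competes at both \<open>v\<close>
  and \<open>w\<close>, and its energy is linear in the weight.\<close>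

lemma concave_on_minimal_energy: "concave_on pos_weights minimal_energy"
  unfolding concave_on_iff
proof (intro conjI ballI allI impI)
  fix v w :: "real ^ 'e" and a b :: real
  assume vw: "v \<in> pos_weights" "w \<in> pos_weights" and ab: "0 \<le> a" "0 \<le> b" "a + b = 1"
  let ?u = "a *\<^sub>R v + b *\<^sub>R w"
  have u: "?u \<in> pos_weights" using convexD[OF convex_pos_weights vw ab] .
  have "a * minimal_energy v + b * minimal_energy w
      \<le> a * energy r v (minimizer ?u) + b * energy r w (minimizer ?u)"
    using vw u ab by (intro add_mono mult_left_mono minimal_energy_le minimizer_in) auto
  also have "\<dots> = energy r ?u (minimizer ?u)"
    by (simp add: energy_def sum_distrib_left sum.distrib algebra_simps)
  finally show "a * minimal_energy v + b * minimal_energy w \<le> minimal_energy ?u"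
    using minimal_energy_eq[OF u] by simp
qed (rule convex_pos_weights)

text \<open>An envelope theorem: the increment from \<open>w\<close> to \<open>v\<close> lies
  between \<open>g v\<close> and \<open>g w\<close>, each paired with \<open>v - w\<close>. The
  relative error is at most \<open>norm (g v - g w)\<close>, which vanishes in the limit because the
  minimiser is continuous.\<close>

lemma has_derivative_minimal_energy:
  assumes w: "w \<in> pos_weights"
  shows "(minimal_energy has_derivative (\<lambda>h. (\<chi> e. minimizer w $ e powr r) \<bullet> h)) (at w)"
proof -
  define g where "g v = (\<chi> e. minimizer v $ e powr r)" for v
  have "continuous_on pos_weights g"
    unfolding g_def using minimizer_in nonneg_A r_gt_1
    by (intro continuous_intros continuous_on_powr' continuous_on_minimizer) auto
  then have lim: "(g \<longlongrightarrow> g w) (at w within pos_weights)"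
    using w by (simp add: continuous_on_def)
  have "(minimal_energy has_derivative (\<lambda>h. g w \<bullet> h)) (at w within pos_weights)"
  proof (rule has_derivativeI_sandwich[where e = 1 and H = "\<lambda>v. norm (g v - g w)"])
    fix v assume v: "v \<in> pos_weights" "v \<noteq> w"
    have "minimal_energy v - minimal_energy w \<le> g w \<bullet> (v - w)"
      using minimal_energy_le[OF v(1) minimizer_in[OF w]] minimal_energy_eq[OF w]
        energy_diff_weights[of r v "minimizer w" w] by (simp add: g_def)
    moreover have "g v \<bullet> (v - w) \<le> minimal_energy v - minimal_energy w"
      using minimal_energy_le[OF w minimizer_in[OF v(1)]] minimal_energy_eq[OF v(1)]
        energy_diff_weights[of r v "minimizer v" w] by (simp add: g_def)
    ultimately have "norm (minimal_energy v - minimal_energy w - g w \<bullet> (v - w))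
        \<le> \<bar>(g v - g w) \<bullet> (v - w)\<bar>"
      by (simp add: inner_diff_left)
    also have "\<dots> \<le> norm (g v - g w) * norm (v - w)" by (rule Cauchy_Schwarz_ineq2)
    finally show "norm (minimal_energy v - minimal_energy w - g w \<bullet> (v - w)) / norm (v - w)
        \<le> norm (g v - g w)"
      using v(2) by (simp add: divide_le_eq)
  next
    show "((\<lambda>v. norm (g v - g w)) \<longlongrightarrow> 0) (at w within pos_weights)"
      using lim by (simp add: LIM_zero tendsto_norm_zero)
  qed (auto intro: bounded_linear_inner_right)
  then show ?thesis
    unfolding g_def using at_within_open[OF w open_pos_weights] by simp
qed

section \<open>Monotonicity in the weights\<close>

lemma minimal_energy_mono:
  assumes "w \<in> pos_weights" "w' \<in> pos_weights" "\<And>e. w $ e \<le> w' $ e"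
  shows "minimal_energy w \<le> minimal_energy w'"
proof -
  have "minimal_energy w \<le> energy r w (minimizer w')"
    using assms by (intro minimal_energy_le minimizer_in)
  also have "\<dots> \<le> energy r w' (minimizer w')" by (rule energy_mono[OF assms(3)])
  finally show ?thesis using minimal_energy_eq[OF assms(2)] by simp
qed

lemma minimizer_antimono_coordinate:
  assumes w: "w \<in> pos_weights" "w' \<in> pos_weights"
    and eq: "\<And>e'. e' \<noteq> e \<Longrightarrow> w' $ e' = w $ e'" and le: "w $ e \<le> w' $ e"
  shows "minimizer w' $ e \<le> minimizer w $ e"
proof (cases "w $ e = w' $ e")
  case True
  then have "w' = w" using eq by (metis vec_eq_iff)
  then show ?thesis by simp
next
  case False
  \<comment> \<open>Only coordinate \<open>e\<close> of the weight changes, so in the sum of the two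
    optimality inequalities only the powers at \<open>e\<close> survive.\<close>
  have *: "energy r w' x - energy r w x = (w' $ e - w $ e) * x $ e powr r" for x
  proof -
    have "w' - w = (w' $ e - w $ e) *\<^sub>R axis e 1"
      using eq by (auto simp: vec_eq_iff axis_def)
    then show ?thesis by (simp add: energy_diff_weights inner_axis)
  qed
  have "energy r w (minimizer w) \<le> energy r w (minimizer w')"
       "energy r w' (minimizer w') \<le> energy r w' (minimizer w)"
    using w by (auto intro: minimizer_le minimizer_in)
  then have "(w' $ e - w $ e) * minimizer w' $ e powr r
      \<le> (w' $ e - w $ e) * minimizer w $ e powr r"
    using *[of "minimizer w"] *[of "minimizer w'"] by linarith
  then have "minimizer w' $ e powr r \<le> minimizer w $ e powr r"
    using False le by simp
  then show ?thesis
    using powr_less_mono2[of r "minimizer w $ e" "minimizer w' $ e"] r_gt_1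
      nonneg_A[OF minimizer_in[OF w(1)], of e] by fastforce
qed

end

section \<open>Time-respecting paths\<close>

lemma finite_trps:
  fixes G :: "('v, 'e::finite) temporal_graph"
  assumes "wf_temporal_graph G"
  shows "finite (trps G s t)"
proof (rule finite_subset)
  show "trps G s t \<subseteq> Pow (SIGMA e:UNIV. avail G e)"
    by (auto simp: trps_def time_respecting_def set_zip)
  show "finite (Pow (SIGMA e:UNIV. avail G e))"
    using assms by (auto simp: wf_temporal_graph_def)
qed

lemma simple_trps_subset_trps: "simple_trps G s t \<subseteq> trps G s t"
  by (auto simp: simple_trps_def trps_def)

lemma usage_nonneg: "temporal_penalty \<phi> \<Longrightarrow> 0 \<le> usage \<phi> \<gamma> e"
  by (auto simp: usage_def temporal_penalty_def)

text \<open>The first edge of the path is a witness: its time is positive, so its penalty exceeds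
  \<open>\<phi> 0 = 1\<close>.\<close>

lemma trps_usage_ge_1:
  assumes "wf_temporal_graph G" "temporal_penalty \<phi>" "s \<noteq> t" "\<gamma> \<in> trps G s t"
  shows "\<exists>e. 1 \<le> usage \<phi> \<gamma> e"
proof -
  obtain us es ts where \<gamma>: "\<gamma> = set (zip es ts)" and trp: "time_respecting G s t us es ts"
    using assms(4) by (auto simp: trps_def)
  have len: "length us = Suc (length es)" "length ts = length es" and "distinct es"
    using trp by (auto simp: time_respecting_def)
  \<comment> \<open>Without edges the vertex list is a single vertex, which would force
    \<open>s = t\<close>.\<close>
  have "es \<noteq> []"
    using trp assms(3) by (auto simp: time_respecting_def length_Suc_conv)
  then obtain e es' \<tau> ts' where *: "es = e # es'" "ts = \<tau> # ts'"
    using len by (metis length_0_conv neq_Nil_conv)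
  have "(THE \<tau>'. (e, \<tau>') \<in> \<gamma>) = \<tau>"
    using \<open>distinct es\<close> unfolding \<gamma> * by (intro the_equality) (auto dest: set_zip_leftD)
  moreover have "(e, \<tau>) \<in> \<gamma>" unfolding \<gamma> * by simp
  ultimately have "usage \<phi> \<gamma> e = \<phi> \<tau>" by (auto simp: usage_def)
  moreover have "0 < \<tau>"
    using trp assms(1) unfolding * by (fastforce simp: time_respecting_def wf_temporal_graph_def)
  then have "1 < \<phi> \<tau>"
    using assms(2) strict_monoD[of \<phi> 0 \<tau>] by (simp add: temporal_penalty_def)
  ultimately show ?thesis
    by (intro exI[of _ e]) simp
qed

section \<open>The set of admissible densities\<close>

lemma Adm_closed: "closed (Adm \<phi> \<Gamma>)"
proof -
  have "Adm \<phi> \<Gamma> = (\<Inter>e. {\<rho>. 0 \<le> \<rho> $ e}) \<inter> (\<Inter>\<gamma>\<in>\<Gamma>. {\<rho>. 1 \<le> rho_length \<phi> \<rho> \<gamma>})"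
    by (auto simp: Adm_def)
  then show ?thesis
    unfolding rho_length_def
    by (auto intro!: closed_Int closed_INT closed_Collect_le continuous_intros)
qed

lemma Adm_convex: "convex (Adm \<phi> \<Gamma>)"
proof (rule convexI)
  fix x y and u v :: real
  assume xy: "x \<in> Adm \<phi> \<Gamma>" "y \<in> Adm \<phi> \<Gamma>" and uv: "0 \<le> u" "0 \<le> v" "u + v = 1"
  have "1 \<le> rho_length \<phi> (u *\<^sub>R x + v *\<^sub>R y) \<gamma>" if "\<gamma> \<in> \<Gamma>" for \<gamma>
  proof -
    have "u * 1 + v * 1 \<le> u * rho_length \<phi> x \<gamma> + v * rho_length \<phi> y \<gamma>"
      using xy uv that by (intro add_mono mult_left_mono) (auto simp: Adm_def)
    also have "\<dots> = rho_length \<phi> (u *\<^sub>R x + v *\<^sub>R y) \<gamma>"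
      by (simp add: rho_length_def sum_distrib_left sum.distrib algebra_simps)
    finally show ?thesis using uv by simp
  qed
  then show "u *\<^sub>R x + v *\<^sub>R y \<in> Adm \<phi> \<Gamma>"
    using xy uv by (auto simp: Adm_def)
qed

text \<open>The constant density 1 is admissible, since one edge of each path already contributes
  length 1.\<close>

lemma Adm_nonempty:
  assumes "temporal_penalty \<phi>" "\<And>\<gamma>. \<gamma> \<in> \<Gamma> \<Longrightarrow> \<exists>e. 1 \<le> usage \<phi> \<gamma> e"
  shows "Adm \<phi> \<Gamma> \<noteq> {}"
proof -
  have "1 \<le> rho_length \<phi> 1 \<gamma>" if \<gamma>: "\<gamma> \<in> \<Gamma>" for \<gamma>
  proof -
    obtain e where "1 \<le> usage \<phi> \<gamma> e" using assms(2)[OF \<gamma>] ..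
    also have "\<dots> \<le> (\<Sum>e\<in>UNIV. usage \<phi> \<gamma> e)"
      by (rule member_le_sum) (auto intro: usage_nonneg[OF assms(1)])
    finally show ?thesis by (simp add: rho_length_def)
  qed
  then have "1 \<in> Adm \<phi> \<Gamma>" by (simp add: Adm_def)
  then show ?thesis by blast
qed

section \<open>The polytope of edge usages\<close>

text \<open>Mass functions are the coefficients of convex combinations of the rows of the usage
  matrix. As the hull of finitely many points, the feasible set is compact and convex.\<close>

lemma edge_usages_eq_convex_hull:
  assumes fin: "finite \<Gamma>"
  shows "edge_usage \<phi> \<Gamma> ` mass_functions \<Gamma> = convex hull ((\<lambda>\<gamma>. \<chi> e. usage \<phi> \<gamma> e) ` \<Gamma>)"
    (is "?L = convex hull (?u ` \<Gamma>)")
proof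
  have eq: "edge_usage \<phi> \<Gamma> \<mu> = (\<Sum>\<gamma>\<in>\<Gamma>. \<mu> \<gamma> *\<^sub>R ?u \<gamma>)" for \<mu>
    by (simp add: edge_usage_def vec_eq_iff mult.commute)
  show "?L \<subseteq> convex hull (?u ` \<Gamma>)"
  proof
    fix \<eta> assume "\<eta> \<in> ?L"
    then obtain \<mu> where "\<mu> \<in> mass_functions \<Gamma>" "\<eta> = (\<Sum>\<gamma>\<in>\<Gamma>. \<mu> \<gamma> *\<^sub>R ?u \<gamma>)"
      using eq by auto
    then show "\<eta> \<in> convex hull (?u ` \<Gamma>)"
      using convex_sum[OF fin convex_convex_hull, of \<mu> ?u "?u ` \<Gamma>"]
      by (simp add: mass_functions_def hull_inc)
  qed
  show "convex hull (?u ` \<Gamma>) \<subseteq> ?L"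
  proof (rule hull_minimal)
    show "?u ` \<Gamma> \<subseteq> ?L"
    proof clarify
      fix \<gamma> assume \<gamma>: "\<gamma> \<in> \<Gamma>"
      \<comment> \<open>The point mass at a path yields that path's row.\<close>
      let ?\<mu> = "\<lambda>\<gamma>'. if \<gamma>' = \<gamma> then 1 else 0 :: real"
      have "?\<mu> \<in> mass_functions \<Gamma>" using fin \<gamma> by (simp add: mass_functions_def)
      moreover have "?u \<gamma> = edge_usage \<phi> \<Gamma> ?\<mu>"
        using fin \<gamma> by (simp add: edge_usage_def vec_eq_iff if_distrib cong: if_cong)
      ultimately show "?u \<gamma> \<in> ?L" by blast
    qed
    show "convex ?L"
    proof (rule convexI)
      fix x y and a b :: real
      assume "x \<in> ?L" "y \<in> ?L" and ab: "0 \<le> a" "0 \<le> b" "a + b = 1"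
      then obtain \<mu> \<nu> where mn: "\<mu> \<in> mass_functions \<Gamma>" "\<nu> \<in> mass_functions \<Gamma>"
        "x = edge_usage \<phi> \<Gamma> \<mu>" "y = edge_usage \<phi> \<Gamma> \<nu>" by auto
      have "(\<lambda>\<gamma>. a * \<mu> \<gamma> + b * \<nu> \<gamma>) \<in> mass_functions \<Gamma>"
        using mn ab by (auto simp: mass_functions_def sum.distrib sum_distrib_left[symmetric])
      moreover have "a *\<^sub>R x + b *\<^sub>R y = edge_usage \<phi> \<Gamma> (\<lambda>\<gamma>. a * \<mu> \<gamma> + b * \<nu> \<gamma>)"
        using mn by (simp add: edge_usage_def vec_eq_iff sum.distrib sum_distrib_left algebra_simps)
      ultimately show "a *\<^sub>R x + b *\<^sub>R y \<in> ?L" by blast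
    qed
  qed
qed

section \<open>Modulus and transport as instances of the minimisation problem\<close>

lemma transport_cost_eq_energy:
  "transport_cost p q \<sigma> = energy q (\<chi> e. \<sigma> $ e powr (- q / p))"
  by (auto simp: transport_cost_def energy_def)

theorem theorem3p3:
  fixes G :: "('v, 'e::finite) temporal_graph"
    and s t :: 'v
    and \<Gamma> :: "('e \<times> real) set set"
    and \<phi> :: "real \<Rightarrow> real"
    and p q :: real
  assumes "wf_temporal_graph G"
    and "s \<in> verts G" and "t \<in> verts G" and "s \<noteq> t"
    and "temporal_penalty \<phi>"
    and "\<Gamma> = trps G s t \<or> \<Gamma> = simple_trps G s t"
    and "\<Gamma> \<noteq> {}"
    and "1 < p" and "q = p / (p - 1)"
  shows
    "(\<forall>\<sigma>\<in>pos_weights. \<exists>!\<rho>. is_optimal_density \<phi> \<Gamma> p \<sigma> \<rho>) \<and>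
     (\<forall>\<sigma>\<in>pos_weights. \<exists>!\<eta>. is_optimal_usage \<phi> \<Gamma> p q \<sigma> \<eta>) \<and>
     continuous_on pos_weights (opt_density \<phi> \<Gamma> p) \<and>
     concave_on pos_weights (modulus \<phi> \<Gamma> p) \<and>
     (\<forall>\<sigma>\<in>pos_weights. modulus \<phi> \<Gamma> p differentiable (at \<sigma>)) \<and>
     (\<forall>\<sigma>\<in>pos_weights. \<forall>e.
        ((\<lambda>x. modulus \<phi> \<Gamma> p (\<sigma> + x *\<^sub>R axis e 1)) has_real_derivative
           (opt_density \<phi> \<Gamma> p \<sigma> $ e) powr p) (at 0)) \<and>
     (\<forall>e. \<forall>\<sigma>\<in>pos_weights. \<forall>\<sigma>'\<in>pos_weights.
        (\<forall>e'. e' \<noteq> e \<longrightarrow> \<sigma>' $ e' = \<sigma> $ e') \<and> \<sigma> $ e \<le> \<sigma>' $ e \<longrightarrow>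
          modulus \<phi> \<Gamma> p \<sigma> \<le> modulus \<phi> \<Gamma> p \<sigma>' \<and>
          opt_usage \<phi> \<Gamma> p q \<sigma> $ e \<le> opt_usage \<phi> \<Gamma> p q \<sigma>' $ e \<and>
          opt_density \<phi> \<Gamma> p \<sigma>' $ e \<le> opt_density \<phi> \<Gamma> p \<sigma> $ e)"
proof -
  have sub: "\<Gamma> \<subseteq> trps G s t"
    using assms(6) simple_trps_subset_trps[of G s t] by blast
  have fin: "finite \<Gamma>" and use1: "\<And>\<gamma>. \<gamma> \<in> \<Gamma> \<Longrightarrow> \<exists>e. 1 \<le> usage \<phi> \<gamma> e"
    using sub trps_usage_ge_1[OF assms(1,5,4)] finite_subset[OF sub finite_trps[OF assms(1)]]
    by auto
  have p: "1 < p" and q: "1 < q" using assms(8,9) by (auto simp: less_divide_eq)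

  interpret D: energy_minimization "Adm \<phi> \<Gamma>" p
  proof
    show "0 \<le> x $ e" if "x \<in> Adm \<phi> \<Gamma>" for x e
      using that by (simp add: Adm_def)
    show "Adm \<phi> \<Gamma> \<noteq> {}"
      by (rule Adm_nonempty[OF assms(5)]) (rule use1)
  qed (rule Adm_closed Adm_convex p)+
  define H where "H = edge_usage \<phi> \<Gamma> ` mass_functions \<Gamma>"
  have H: "H = convex hull ((\<lambda>\<gamma>. \<chi> e. usage \<phi> \<gamma> e) ` \<Gamma>)"
    unfolding H_def by (rule edge_usages_eq_convex_hull[OF fin])
  interpret U: energy_minimization H q
  proof
    show "closed H" unfolding H
      using fin by (intro compact_imp_closed finite_imp_compact_convex_hull) auto
    show "convex H" "H \<noteq> {}" unfolding H using assms(7) by auto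
    show "0 \<le> x $ e" if "x \<in> H" for x e
      using that
      by (auto simp: H_def edge_usage_def mass_functions_def usage_nonneg[OF assms(5)]
          intro!: sum_nonneg)
  qed (rule q)

  have is_density: "is_optimal_density \<phi> \<Gamma> p = D.is_minimizer"
    by (simp add: is_optimal_density_def fun_eq_iff)
  have density: "opt_density \<phi> \<Gamma> p = D.minimizer"
    by (simp add: opt_density_def D.minimizer_def is_density fun_eq_iff)
  have modulus: "modulus \<phi> \<Gamma> p = D.minimal_energy"
    by (simp add: modulus_def D.minimal_energy_def fun_eq_iff)

  define W :: "real ^ 'e \<Rightarrow> real ^ 'e" where "W \<sigma> = (\<chi> e. \<sigma> $ e powr (- q / p))" for \<sigma>
  have W: "W \<sigma> \<in> pos_weights" if "\<sigma> \<in> pos_weights" for \<sigma>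
    using that by (auto simp: W_def pos_weights_def less_le)
  have is_usage: "is_optimal_usage \<phi> \<Gamma> p q \<sigma> = U.is_minimizer (W \<sigma>)" for \<sigma>
    by (simp add: is_optimal_usage_def fun_eq_iff transport_cost_eq_energy W_def H_def)
  have usage: "opt_usage \<phi> \<Gamma> p q \<sigma> = U.minimizer (W \<sigma>)" for \<sigma>
    by (simp add: opt_usage_def U.minimizer_def is_usage)

  \<comment> \<open>Chain rule along the line in direction \<open>axis e 1\<close>; pairing the
    gradient with that axis picks out its entry at \<open>e\<close>.\<close>
  have partial: "((\<lambda>x. D.minimal_energy (\<sigma> + x *\<^sub>R axis e 1)) has_real_derivative
      D.minimizer \<sigma> $ e powr p) (at 0)" if \<sigma>: "\<sigma> \<in> pos_weights" for \<sigma> e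
  proof -
    have "((\<lambda>x::real. \<sigma> + x *\<^sub>R axis e 1) has_derivative (\<lambda>x. x *\<^sub>R axis e 1)) (at 0)"
      by (auto intro!: derivative_eq_intros)
    moreover have "(D.minimal_energy has_derivative (\<lambda>h. (\<chi> e. D.minimizer \<sigma> $ e powr p) \<bullet> h))
        (at (\<sigma> + 0 *\<^sub>R axis e 1))"
      using D.has_derivative_minimal_energy[OF \<sigma>] by simp
    ultimately have "((\<lambda>x. D.minimal_energy (\<sigma> + x *\<^sub>R axis e 1)) has_derivative
        (\<lambda>x. (\<chi> e. D.minimizer \<sigma> $ e powr p) \<bullet> (x *\<^sub>R axis e 1))) (at 0)"
      by (rule has_derivative_compose)
    then show ?thesis
      by (simp add: has_field_derivative_def inner_axis
          mult.commute[of _ "D.minimizer \<sigma> $ e powr p"])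
  qed

  have mono: "D.minimal_energy \<sigma> \<le> D.minimal_energy \<sigma>' \<and>
      U.minimizer (W \<sigma>) $ e \<le> U.minimizer (W \<sigma>') $ e \<and>
      D.minimizer \<sigma>' $ e \<le> D.minimizer \<sigma> $ e"
    if \<sigma>: "\<sigma> \<in> pos_weights" "\<sigma>' \<in> pos_weights"
      and eq: "\<And>e'. e' \<noteq> e \<Longrightarrow> \<sigma>' $ e' = \<sigma> $ e'" and le: "\<sigma> $ e \<le> \<sigma>' $ e" for \<sigma> \<sigma>' e
  proof (intro conjI)
    have "\<sigma> $ e' \<le> \<sigma>' $ e'" for e' using eq le by (cases "e' = e") auto
    then show "D.minimal_energy \<sigma> \<le> D.minimal_energy \<sigma>'"
      by (rule D.minimal_energy_mono[OF \<sigma>])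
    show "D.minimizer \<sigma>' $ e \<le> D.minimizer \<sigma> $ e"
      using \<sigma> eq le by (rule D.minimizer_antimono_coordinate)
    \<comment> \<open>The exponent \<open>- q / p\<close> is negative, so raising the weight at
      \<open>e\<close> lowers the transport weight there and leaves the others unchanged. The
      antitone comparison of minimisers therefore turns into monotonicity of the usage.\<close>
    have "W \<sigma>' $ e \<le> W \<sigma> $ e"
      using le p q pos_weights_pos[OF \<sigma>(1), of e] by (auto simp: W_def intro!: powr_mono2')
    then show "U.minimizer (W \<sigma>) $ e \<le> U.minimizer (W \<sigma>') $ e"
      using W[OF \<sigma>(1)] W[OF \<sigma>(2)] eq by (intro U.minimizer_antimono_coordinate) (auto simp: W_def)
  qed

  show ?thesis
    unfolding is_density density modulus is_usage usage
  proof (intro conjI ballI allI)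
    show "D.minimal_energy differentiable (at \<sigma>)" if "\<sigma> \<in> pos_weights" for \<sigma>
      using D.has_derivative_minimal_energy[OF that] unfolding differentiable_def by blast
    show "(\<forall>e'. e' \<noteq> e \<longrightarrow> \<sigma>' $ e' = \<sigma> $ e') \<and> \<sigma> $ e \<le> \<sigma>' $ e \<longrightarrow>
        D.minimal_energy \<sigma> \<le> D.minimal_energy \<sigma>' \<and>
        U.minimizer (W \<sigma>) $ e \<le> U.minimizer (W \<sigma>') $ e \<and>
        D.minimizer \<sigma>' $ e \<le> D.minimizer \<sigma> $ e"
      if "\<sigma> \<in> pos_weights" "\<sigma>' \<in> pos_weights" for \<sigma> \<sigma>' e
      by (intro impI mono that) auto
  qed (use D.ex1_minimizer U.ex1_minimizer W D.continuous_on_minimizer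
      D.concave_on_minimal_energy partial in auto)
qed

end
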